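(* Let $A=(a_{ij})\in\mathbb{R}^{n\times n}$ be a symmetric matrix and let $\varphi(x)=\frac12\langle Ax,x\rangle$ for $x\in\mathbb{R}^n$. For $i=1,\dots,n$ put $b_i=\sum_{j=1}^n|a_{ij}|$ and $d_i=\max\{b_i-a_{ii},0\}$. Let $A_2=\mathrm{diag}(d_1,\dots,d_n)$ and let $A_1=A+A_2$, that is, $A_1$ is the matrix with diagonal entries $a_{ii}+d_i$ and off-diagonal entries $a_{ij}$ ($i\ne j$). Then $A_1$ and $A_2$ are positive semidefinite; hence $\varphi$ can be represented as a difference of convex functions $\varphi(x)=\varphi_1(x)-\varphi_2(x)$ for all $x\in\mathbb{R}^n$, where $$\varphi_1(x)=\tfrac12\langle A_1x,x\rangle,\qquad \varphi_2(x)=\tfrac12\langle A_2x,x\rangle .$$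
   Context: $\langle\cdot,\cdot\rangle$ is the standard inner product on $\mathbb{R}^n$. A DC (difference of convex) representation of a function $\varphi:\mathbb{R}^n\to\mathbb{R}$ is an expression $\varphi=\varphi_1-\varphi_2$ with $\varphi_1,\varphi_2:\mathbb{R}^n\to\mathbb{R}$ convex. *)

theory Defs
  imports "HOL-Analysis.Analysis"
begin

definition symmetric_mat :: "real^'n^'n \<Rightarrow> bool" where
  "symmetric_mat A \<longleftrightarrow> transpose A = A"

text \<open>Symmetry is part of the notion; the quadratic-form condition alone does not imply it over the reals.\<close>

definition psd_mat :: "real^'n^'n \<Rightarrow> bool" where
  "psd_mat A \<longleftrightarrow> symmetric_mat A \<and> (\<forall>x. 0 \<le> (A *v x) \<bullet> x)"

definition diag_mat :: "('n \<Rightarrow> real) \<Rightarrow> real^'n^'n" where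
  "diag_mat d = (\<chi> i j. if i = j then d i else 0)"

definition dc_representation ::
    "('a::real_vector \<Rightarrow> real) \<Rightarrow> ('a \<Rightarrow> real) \<Rightarrow> ('a \<Rightarrow> real) \<Rightarrow> bool" where
  "dc_representation f g h \<longleftrightarrow>
     convex_on UNIV g \<and> convex_on UNIV h \<and> (\<forall>x. f x = g x - h x)"

end

theory Submission
  imports Defs
begin

text \<open>
  The diagonal shift \<open>d\<close> is chosen to make \<open>A1\<close> diagonally dominant: its diagonal entry
  \<open>a\<^sub>i\<^sub>i + d\<^sub>i\<close> is at least \<open>b\<^sub>i\<close>, the full absolute row sum of \<open>A\<close>, hence at least the absolute
  sum of the off-diagonal entries of row \<open>i\<close>, which \<open>A\<close> and \<open>A1\<close> share. A symmetric diagonally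
  dominant matrix is positive semidefinite, because each mixed term \<open>m\<^sub>i\<^sub>j x\<^sub>i x\<^sub>j\<close> costs at most
  \<open>\<bar>m\<^sub>i\<^sub>j\<bar> (x\<^sub>i\<^sup>2 + x\<^sub>j\<^sup>2) / 2\<close>, and by symmetry these costs add up to at most what the diagonal
  provides (\<open>diagonally_dominant_imp_psd_mat\<close>). As the matrix \<open>A2\<close> is diagonal with nonnegative
  entries, it is diagonally dominant as well. The quadratic form of a positive semidefinite matrix
  is convex (\<open>convex_on_quadratic_form\<close>), and the three forms are related by linearity in the
  matrix.
\<close>

lemma quadratic_form_expand:
  fixes M :: "real^'n^'n"
  shows "(M *v x) \<bullet> x = (\<Sum>i\<in>UNIV. \<Sum>j\<in>UNIV. M $ i $ j * x $ i * x $ j)"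
  by (simp add: inner_vec_def matrix_vector_mult_def sum_distrib_left sum_distrib_right mult_ac)

lemma symmetric_mat_nth:
  assumes "symmetric_mat M"
  shows "M $ i $ j = M $ j $ i"
proof -
  have "transpose M $ i $ j = M $ i $ j"
    using assms by (simp add: symmetric_mat_def)
  then show ?thesis
    by (simp add: transpose_def)
qed

text \<open>
  This is the positive semidefinite case of Gershgorin's theorem, proved without eigenvalues. With
  \<open>N\<close> the matrix of absolute values of the off-diagonal entries, the inequality
  \<open>2 \<bar>s t\<bar> \<le> s\<^sup>2 + t\<^sup>2\<close> bounds the mixed terms from below by
  \<open>- (1/2) (\<Sum>i j. N i j * (x\<^sub>i\<^sup>2 + x\<^sub>j\<^sup>2))\<close>; since \<open>N\<close> is symmetric, this is minus the sum over \<open>i\<close> of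
  the \<open>i\<close>-th row sum of \<open>N\<close> times \<open>x\<^sub>i\<^sup>2\<close>, which the diagonal of \<open>M\<close> outweighs.
\<close>

lemma diagonally_dominant_imp_psd_mat:
  fixes M :: "real^'n^'n"
  assumes sym: "symmetric_mat M"
    and dom: "\<And>i. (\<Sum>j\<in>UNIV - {i}. \<bar>M $ i $ j\<bar>) \<le> M $ i $ i"
  shows "psd_mat M"
proof -
  have "0 \<le> (M *v x) \<bullet> x" for x
  proof -
    define N where "N i j = (if i = j then 0 else \<bar>M $ i $ j\<bar>)" for i j
    define D where "D i j = (if i = j then M $ i $ i else 0)" for i j
    have N_sym: "N i j = N j i" for i j
      using symmetric_mat_nth[OF sym, of i j] by (simp add: N_def)
    have N_row: "(\<Sum>j\<in>UNIV. N i j) \<le> M $ i $ i" for i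
    proof -
      have "(\<Sum>j\<in>UNIV. N i j) = (\<Sum>j\<in>UNIV - {i}. N i j)"
        by (rule sum.mono_neutral_right) (auto simp: N_def)
      also have "\<dots> = (\<Sum>j\<in>UNIV - {i}. \<bar>M $ i $ j\<bar>)"
        by (rule sum.cong) (auto simp: N_def)
      finally show ?thesis
        using dom[of i] by simp
    qed
    define S where "S = (\<Sum>i\<in>UNIV. \<Sum>j\<in>UNIV. N i j * (x $ i)\<^sup>2)"
    have S_swap: "S = (\<Sum>i\<in>UNIV. \<Sum>j\<in>UNIV. N i j * (x $ j)\<^sup>2)"
      unfolding S_def by (subst sum.swap) (simp add: N_sym)
    have entry: "D i j * (x $ i)\<^sup>2 - (N i j * (x $ i)\<^sup>2 + N i j * (x $ j)\<^sup>2) / 2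
        \<le> M $ i $ j * x $ i * x $ j" for i j
    proof (cases "i = j")
      case True
      then show ?thesis by (simp add: D_def N_def power2_eq_square)
    next
      case False
      have "2 * \<bar>x $ i * x $ j\<bar> \<le> (x $ i)\<^sup>2 + (x $ j)\<^sup>2"
        using sum_squares_bound[of "\<bar>x $ i\<bar>" "\<bar>x $ j\<bar>"] by (simp add: abs_mult)
      then have "N i j * (2 * \<bar>x $ i * x $ j\<bar>) \<le> N i j * ((x $ i)\<^sup>2 + (x $ j)\<^sup>2)"
        by (rule mult_left_mono) (simp add: N_def)
      then have "- ((N i j * (x $ i)\<^sup>2 + N i j * (x $ j)\<^sup>2) / 2) \<le> - (N i j * \<bar>x $ i * x $ j\<bar>)"
        by (simp add: field_simps)
      also have "\<dots> \<le> M $ i $ j * x $ i * x $ j"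
        using False abs_ge_minus_self[of "M $ i $ j * (x $ i * x $ j)"]
        by (simp add: N_def abs_mult mult.assoc)
      finally show ?thesis
        using False by (simp add: D_def)
    qed
    have "0 \<le> (\<Sum>i\<in>UNIV. (M $ i $ i - (\<Sum>j\<in>UNIV. N i j)) * (x $ i)\<^sup>2)"
      using N_row by (intro sum_nonneg mult_nonneg_nonneg) auto
    also have "\<dots> = (\<Sum>i\<in>UNIV. M $ i $ i * (x $ i)\<^sup>2) - S"
      by (simp add: S_def left_diff_distrib sum_subtractf sum_distrib_right)
    also have "\<dots> = (\<Sum>i\<in>UNIV. \<Sum>j\<in>UNIV. D i j * (x $ i)\<^sup>2) - (S + S) / 2"
      by (simp add: D_def if_distrib[of "\<lambda>t. t * _"] cong: if_cong)
    also have "\<dots> = (\<Sum>i\<in>UNIV. \<Sum>j\<in>UNIV.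
        D i j * (x $ i)\<^sup>2 - (N i j * (x $ i)\<^sup>2 + N i j * (x $ j)\<^sup>2) / 2)"
      \<comment> \<open>One copy of \<open>S\<close> supplies the terms in \<open>x\<^sub>i\<^sup>2\<close>, the other those in \<open>x\<^sub>j\<^sup>2\<close>.\<close>
      by (subst (2) S_swap)
        (simp add: S_def sum_subtractf sum.distrib flip: sum_divide_distrib)
    also have "\<dots> \<le> (M *v x) \<bullet> x"
      unfolding quadratic_form_expand by (intro sum_mono entry)
    finally show ?thesis .
  qed
  then show ?thesis
    using sym by (simp add: psd_mat_def)
qed

text \<open>
  For \<open>q x = (M *v x) \<bullet> x\<close> and \<open>u + v = 1\<close>, the convexity gap
  \<open>u * q x + v * q y - q (u x + v y)\<close> is exactly \<open>u * v * q (x - y)\<close>.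
\<close>

lemma convex_on_quadratic_form:
  fixes M :: "real^'n^'n"
  assumes "psd_mat M"
  shows "convex_on UNIV (\<lambda>x. (M *v x) \<bullet> x)"
proof (rule convex_onI)
  fix t :: real and x y :: "real^'n"
  assume t: "0 < t" "t < 1"
  have "(1 - t) * ((M *v x) \<bullet> x) + t * ((M *v y) \<bullet> y)
      - (M *v ((1 - t) *\<^sub>R x + t *\<^sub>R y)) \<bullet> ((1 - t) *\<^sub>R x + t *\<^sub>R y)
      = (1 - t) * t * ((M *v (x - y)) \<bullet> (x - y))"
    by (simp add: matrix_vector_right_distrib matrix_vector_mult_diff_distrib
        matrix_vector_mult_scaleR inner_add_left inner_add_right inner_diff_left inner_diff_right
        algebra_simps)
  also have "\<dots> \<ge> 0"
    using assms t by (simp add: psd_mat_def)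
  finally show "(M *v ((1 - t) *\<^sub>R x + t *\<^sub>R y)) \<bullet> ((1 - t) *\<^sub>R x + t *\<^sub>R y)
      \<le> (1 - t) * ((M *v x) \<bullet> x) + t * ((M *v y) \<bullet> y)"
    by simp
qed simp

lemma symmetric_mat_diag_mat: "symmetric_mat (diag_mat d)"
  by (auto simp: symmetric_mat_def diag_mat_def transpose_def vec_eq_iff)

lemma symmetric_mat_add:
  assumes "symmetric_mat A" "symmetric_mat B"
  shows "symmetric_mat (A + B)"
  using symmetric_mat_nth[OF assms(1)] symmetric_mat_nth[OF assms(2)]
  by (simp add: symmetric_mat_def transpose_def vec_eq_iff)

theorem proposition1:
  fixes A A1 A2 :: "real^'n^'n"
    and b d :: "'n \<Rightarrow> real"
    and \<phi> \<phi>1 \<phi>2 :: "real^'n \<Rightarrow> real"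
  assumes "symmetric_mat A"
    and "\<And>x. \<phi> x = 1/2 * ((A *v x) \<bullet> x)"
    and "\<And>i. b i = (\<Sum>j\<in>UNIV. \<bar>A $ i $ j\<bar>)"
    and "\<And>i. d i = max (b i - A $ i $ i) 0"
    and "A2 = diag_mat d"
    and "A1 = A + A2"
    and "\<And>x. \<phi>1 x = 1/2 * ((A1 *v x) \<bullet> x)"
    and "\<And>x. \<phi>2 x = 1/2 * ((A2 *v x) \<bullet> x)"
  shows "(\<forall>i j. A1 $ i $ j = (if i = j then A $ i $ i + d i else A $ i $ j))
       \<and> psd_mat A1 \<and> psd_mat A2 \<and> dc_representation \<phi> \<phi>1 \<phi>2"
proof -
  have A2_nth: "A2 $ i $ j = (if i = j then d i else 0)" for i j
    by (simp add: assms(5) diag_mat_def)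
  have A1_nth: "A1 $ i $ j = (if i = j then A $ i $ i + d i else A $ i $ j)" for i j
    by (simp add: assms(6) A2_nth)
  have psd2: "psd_mat A2"
  proof (rule diagonally_dominant_imp_psd_mat)
    show "symmetric_mat A2"
      by (simp add: assms(5) symmetric_mat_diag_mat)
    show "(\<Sum>j\<in>UNIV - {i}. \<bar>A2 $ i $ j\<bar>) \<le> A2 $ i $ i" for i
      by (simp add: A2_nth assms(4))
  qed
  have psd1: "psd_mat A1"
  proof (rule diagonally_dominant_imp_psd_mat)
    show "symmetric_mat A1"
      by (simp add: assms(1,5,6) symmetric_mat_diag_mat symmetric_mat_add)
    fix i
    have "(\<Sum>j\<in>UNIV - {i}. \<bar>A1 $ i $ j\<bar>) = (\<Sum>j\<in>UNIV - {i}. \<bar>A $ i $ j\<bar>)"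
      by (rule sum.cong) (auto simp: A1_nth)
    also have "\<dots> \<le> b i"
      unfolding assms(3) by (rule sum_mono2) auto
    also have "\<dots> \<le> A1 $ i $ i"
      by (simp add: A1_nth assms(4))
    finally show "(\<Sum>j\<in>UNIV - {i}. \<bar>A1 $ i $ j\<bar>) \<le> A1 $ i $ i" .
  qed
  have "convex_on UNIV \<phi>1" "convex_on UNIV \<phi>2"
    using convex_on_cmul[OF _ convex_on_quadratic_form[OF psd1], of "1/2"]
      convex_on_cmul[OF _ convex_on_quadratic_form[OF psd2], of "1/2"]
    by (simp_all add: assms(7,8)[abs_def])
  moreover have "\<phi> x = \<phi>1 x - \<phi>2 x" for x
    by (simp add: assms(2,6,7,8) matrix_vector_mult_add_rdistrib inner_add_left field_simps)
  ultimately show ?thesis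
    using A1_nth psd1 psd2 by (simp add: dc_representation_def)
qed

end
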